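(* Let $A\subseteq\omega$ be nonempty. The Medvedev degree of $\mathcal E_A$ is compact (i.e., $\mathcal E_A$ is Medvedev equivalent to a compact subset of $\omega^\omega$) if and only if $A$ has cototal enumeration degree. Consequently, a degree of enumerability is compact if and only if it is cototal.
   Context: $\mathcal E_A=\{f\in\omega^\omega:\mathrm{ran}(f)=A\}$; a degree of enumerability is a Medvedev degree of the form $\deg_{\mathrm s}(\mathcal E_A)$ for nonempty $A$, and it is called cototal if $A$ has cototal enumeration degree. $\mathcal A\leq_{\mathrm s}\mathcal B$ iff there is a Turing functional $\Phi$ with $\Phi(f)$ total and in $\mathcal A$ for all $f\in\mathcal B$; Medvedev equivalence is reducibility both ways, and a Medvedev degree is compact if it contains a compact subset of Baire space. A set $B$ is cototal if $B\leq_{\mathrm e}\overline B$, and an enumeration degree is cototal if it contains a cototal set. *)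

theory Defs
  imports "HOL-Analysis.Function_Topology" "HOL-Library.Nat_Bijection"
begin

text \<open>Partial recursive functions are presented in the unary style: functions of several arguments
  are coded through Cantor pairing \<^const>\<open>prod_encode\<close>, whose projections are initial functions.\<close>

definition pair_op :: "(nat \<rightharpoonup> nat) \<Rightarrow> (nat \<rightharpoonup> nat) \<Rightarrow> (nat \<rightharpoonup> nat)" where
  "pair_op p q x = Option.bind (p x) (\<lambda>y. Option.bind (q x) (\<lambda>z. Some (prod_encode (y, z))))"

primrec rec_value :: "(nat \<rightharpoonup> nat) \<Rightarrow> (nat \<rightharpoonup> nat) \<Rightarrow> nat \<Rightarrow> nat \<Rightarrow> nat option" where
  "rec_value p q a 0 = p a"
| "rec_value p q a (Suc n) =
     Option.bind (rec_value p q a n) (\<lambda>r. q (prod_encode (a, prod_encode (n, r))))"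

definition primrec_op :: "(nat \<rightharpoonup> nat) \<Rightarrow> (nat \<rightharpoonup> nat) \<Rightarrow> (nat \<rightharpoonup> nat)" where
  "primrec_op p q x = (case prod_decode x of (a, n) \<Rightarrow> rec_value p q a n)"

text \<open>Unbounded search diverges if some value is undefined before the first zero.\<close>

definition mu_stops :: "(nat \<rightharpoonup> nat) \<Rightarrow> nat \<Rightarrow> nat \<Rightarrow> bool" where
  "mu_stops p x n \<longleftrightarrow>
     p (prod_encode (x, n)) = Some 0 \<and> (\<forall>m<n. p (prod_encode (x, m)) \<noteq> None)"

definition mu_op :: "(nat \<rightharpoonup> nat) \<Rightarrow> (nat \<rightharpoonup> nat)" where
  "mu_op p x = (if \<exists>n. mu_stops p x n then Some (LEAST n. mu_stops p x n) else None)"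

inductive partial_recursive :: "(nat \<rightharpoonup> nat) \<Rightarrow> bool" where
  zero: "partial_recursive (\<lambda>_. Some 0)"
| succ: "partial_recursive (\<lambda>x. Some (Suc x))"
| left: "partial_recursive (\<lambda>x. Some (fst (prod_decode x)))"
| right: "partial_recursive (\<lambda>x. Some (snd (prod_decode x)))"
| pair: "partial_recursive p \<Longrightarrow> partial_recursive q \<Longrightarrow> partial_recursive (pair_op p q)"
| comp: "partial_recursive p \<Longrightarrow> partial_recursive q \<Longrightarrow> partial_recursive (p \<circ>\<^sub>m q)"
| prec: "partial_recursive p \<Longrightarrow> partial_recursive q \<Longrightarrow> partial_recursive (primrec_op p q)"
| mu: "partial_recursive p \<Longrightarrow> partial_recursive (mu_op p)"

text \<open>A Turing functional sends an oracle to the partial function computed from it by one fixed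
  oracle program; the construction is uniform in the oracle.\<close>

inductive turing_functional :: "((nat \<Rightarrow> nat) \<Rightarrow> (nat \<rightharpoonup> nat)) \<Rightarrow> bool" where
  query: "turing_functional (\<lambda>f x. Some (f x))"
| oracle_free: "partial_recursive p \<Longrightarrow> turing_functional (\<lambda>_. p)"
| pair: "turing_functional F \<Longrightarrow> turing_functional G \<Longrightarrow>
    turing_functional (\<lambda>f. pair_op (F f) (G f))"
| comp: "turing_functional F \<Longrightarrow> turing_functional G \<Longrightarrow>
    turing_functional (\<lambda>f. F f \<circ>\<^sub>m G f)"
| prec: "turing_functional F \<Longrightarrow> turing_functional G \<Longrightarrow>
    turing_functional (\<lambda>f. primrec_op (F f) (G f))"
| mu: "turing_functional F \<Longrightarrow> turing_functional (\<lambda>f. mu_op (F f))"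

definition comp_enumerable :: "nat set \<Rightarrow> bool" where
  "comp_enumerable W \<longleftrightarrow> (\<exists>p. partial_recursive p \<and> W = dom p)"

text \<open>\<^term>\<open>set_decode u\<close> is the finite set with canonical index \<^term>\<open>u\<close>.\<close>

definition enum_reducible :: "nat set \<Rightarrow> nat set \<Rightarrow> bool" where
  "enum_reducible A B \<longleftrightarrow>
     (\<exists>W. comp_enumerable W \<and> A = {n. \<exists>u. prod_encode (n, u) \<in> W \<and> set_decode u \<subseteq> B})"

definition enum_degree :: "nat set \<Rightarrow> nat set set" where
  "enum_degree A = {B. enum_reducible A B \<and> enum_reducible B A}"

definition cototal_set :: "nat set \<Rightarrow> bool" where
  "cototal_set B \<longleftrightarrow> enum_reducible B (- B)"

definition cototal_enum_degree :: "nat set set \<Rightarrow> bool" where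
  "cototal_enum_degree a \<longleftrightarrow> (\<exists>B\<in>a. cototal_set B)"

definition medvedev_reducible :: "(nat \<Rightarrow> nat) set \<Rightarrow> (nat \<Rightarrow> nat) set \<Rightarrow> bool" where
  "medvedev_reducible P Q \<longleftrightarrow>
     (\<exists>F. turing_functional F \<and> (\<forall>f\<in>Q. \<exists>g\<in>P. \<forall>n. F f n = Some (g n)))"

definition medvedev_degree :: "(nat \<Rightarrow> nat) set \<Rightarrow> (nat \<Rightarrow> nat) set set" where
  "medvedev_degree P = {Q. medvedev_reducible P Q \<and> medvedev_reducible Q P}"

text \<open>Here \<^const>\<open>compact\<close> refers to the product topology on \<^typ>\<open>nat \<Rightarrow> nat\<close> with
  \<^typ>\<open>nat\<close> discrete, that is, to Baire space.\<close>

definition compact_medvedev_degree :: "(nat \<Rightarrow> nat) set set \<Rightarrow> bool" where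
  "compact_medvedev_degree d \<longleftrightarrow> (\<exists>K\<in>d. compact K)"

definition enumerations :: "nat set \<Rightarrow> (nat \<Rightarrow> nat) set" where
  "enumerations A = {f. range f = A}"

definition degree_of_enumerability :: "(nat \<Rightarrow> nat) set set \<Rightarrow> bool" where
  "degree_of_enumerability d \<longleftrightarrow> (\<exists>A. A \<noteq> {} \<and> d = medvedev_degree (enumerations A))"

definition cototal_degree_of_enumerability :: "(nat \<Rightarrow> nat) set set \<Rightarrow> bool" where
  "cototal_degree_of_enumerability d \<longleftrightarrow>
     (\<exists>A. A \<noteq> {} \<and> d = medvedev_degree (enumerations A) \<and> cototal_enum_degree (enum_degree A))"

end

theory Submission
  imports Defs
begin

text \<open>Suppose $B$ is enumerated from its complement by axioms $(n, D)$. Then $B$ always meets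
  $\{n\} \cup D$, and a function choosing an element of $B$ in each of these finite sets enumerates
  $B$. These choice functions form a compact set, and one of them can be found by search from any
  enumeration of $B$.

  Conversely, let $K$ be compact, let $\Psi$ map enumerations of $A$ into $K$ and let $\Phi$ map $K$
  into enumerations of $A$. Let $B$ consist of the finite sets of cylinders that fail to cover the
  image of $\Psi$. Non-covering is witnessed by a finite part of an enumeration of $A$, so $B$ is
  enumeration reducible to $A$. By compactness, $n \in A$ iff some finite cover consists of
  cylinders on which $\Phi$ already outputs $n$, so $A$ is enumeration reducible to the complement
  of $B$. Hence the join of $A$ and $B$ is a cototal set in the degree of $A$.\<close>

section \<open>Total computable functionals\<close>

abbreviation pfst :: "nat \<Rightarrow> nat" where "pfst z \<equiv> fst (prod_decode z)"
abbreviation psnd :: "nat \<Rightarrow> nat" where "psnd z \<equiv> snd (prod_decode z)"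

definition computable_op :: "((nat \<Rightarrow> nat) \<Rightarrow> nat \<Rightarrow> nat) \<Rightarrow> bool" where
  "computable_op F \<longleftrightarrow> turing_functional (\<lambda>f x. Some (F f x))"

definition decidable_op :: "((nat \<Rightarrow> nat) \<Rightarrow> nat \<Rightarrow> bool) \<Rightarrow> bool" where
  "decidable_op P \<longleftrightarrow> computable_op (\<lambda>f x. of_bool (P f x))"

text \<open>A query to the zero oracle is itself partial recursive. This carries searches built in
  the oracle calculus back to \<open>partial_recursive\<close>.\<close>

lemma turing_functional_zero_oracle:
  "turing_functional F \<Longrightarrow> partial_recursive (F (\<lambda>_. 0))"
  by (induction rule: turing_functional.induct) (auto intro: partial_recursive.intros)

lemma turing_functional_app:
  assumes "turing_functional F" "computable_op G"
  shows "turing_functional (\<lambda>f x. F f (G f x))"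
  using turing_functional.comp[OF assms(1) assms(2)[unfolded computable_op_def]]
  by (simp add: map_comp_def)

text \<open>Composition lets the closure rules below take argument terms in place of the variable,
  so that \<open>intro\<close> can take compound expressions apart.\<close>

lemma computable_op_app:
  assumes "computable_op F" "computable_op G"
  shows "computable_op (\<lambda>f x. F f (G f x))"
  using turing_functional_app[OF assms(1)[unfolded computable_op_def] assms(2)]
  by (simp add: computable_op_def)

text \<open>The identity is not an initial function; pairing the two projections recovers
  it.\<close>

lemma computable_op_id: "computable_op (\<lambda>f x. x)"
  using turing_functional.oracle_free[OF partial_recursive.pair[OF partial_recursive.left partial_recursive.right]]
  by (simp add: pair_op_def[abs_def] computable_op_def)

lemma computable_op_query: "computable_op A \<Longrightarrow> computable_op (\<lambda>f x. f (A f x))"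
  by (rule computable_op_app[where F = "\<lambda>f x. f x"])
    (auto simp: computable_op_def intro: turing_functional.query)

lemma computable_op_Suc: "computable_op A \<Longrightarrow> computable_op (\<lambda>f x. Suc (A f x))"
  by (rule computable_op_app[where F = "\<lambda>f x. Suc x"])
    (auto simp: computable_op_def intro: turing_functional.oracle_free partial_recursive.intros)

lemma computable_op_pfst: "computable_op A \<Longrightarrow> computable_op (\<lambda>f x. pfst (A f x))"
  by (rule computable_op_app[where F = "\<lambda>f x. pfst x"])
    (auto simp: computable_op_def intro: turing_functional.oracle_free partial_recursive.intros)

lemma computable_op_psnd: "computable_op A \<Longrightarrow> computable_op (\<lambda>f x. psnd (A f x))"
  by (rule computable_op_app[where F = "\<lambda>f x. psnd x"])
    (auto simp: computable_op_def intro: turing_functional.oracle_free partial_recursive.intros)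

lemma computable_op_const: "computable_op (\<lambda>f x. c)"
proof (induction c)
  case 0
  show ?case
    by (auto simp: computable_op_def intro: turing_functional.oracle_free partial_recursive.intros)
qed (rule computable_op_Suc)

lemma computable_op_pair:
  assumes "computable_op A" "computable_op B"
  shows "computable_op (\<lambda>f x. prod_encode (A f x, B f x))"
  using turing_functional.pair[OF assms[unfolded computable_op_def]]
  by (simp add: computable_op_def pair_op_def[abs_def])

text \<open>\<open>S\<close> takes parameter, counter and previous value in the order in which
  \<open>rec_value\<close> packs them. The recursion is first computed on pairs of parameter and
  length, then applied to \<open>x\<close> paired with \<open>N f x\<close>.\<close>

lemma computable_op_rec:
  assumes B: "computable_op B"
    and S: "computable_op (\<lambda>f z. S f (pfst z) (pfst (psnd z)) (psnd (psnd z)))"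
    and N: "computable_op N"
  shows "computable_op (\<lambda>f x. rec_nat (B f x) (S f x) (N f x))"
proof -
  let ?S = "\<lambda>f z. S f (pfst z) (pfst (psnd z)) (psnd (psnd z))"
  have "rec_value (\<lambda>x. Some (B f x)) (\<lambda>z. Some (?S f z)) a n = Some (rec_nat (B f a) (S f a) n)"
    for f a n by (induction n) auto
  then have "computable_op (\<lambda>f z. rec_nat (B f (pfst z)) (S f (pfst z)) (psnd z))"
    using turing_functional.prec[OF assms(1,2)[unfolded computable_op_def]]
    by (simp add: computable_op_def primrec_op_def[abs_def] case_prod_unfold)
  from computable_op_app[OF this computable_op_pair[OF computable_op_id N]]
  show ?thesis by simp
qed

lemma computable_op_if:
  assumes "decidable_op P" "computable_op A" "computable_op B"
  shows "computable_op (\<lambda>f x. if P f x then A f x else B f x)"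
proof -
  \<comment> \<open>A recursion of length 0 returns \<open>B\<close>, one of length 1 returns
    \<open>A\<close>.\<close>
  have "computable_op (\<lambda>f x. rec_nat (B f x) (\<lambda>n r. A f x) (of_bool (P f x)))"
    by (intro computable_op_rec computable_op_app[OF assms(2)] computable_op_pfst computable_op_id
        assms assms(1)[unfolded decidable_op_def])
  moreover have "rec_nat (B f x) (\<lambda>n r. A f x) (of_bool (P f x)) = (if P f x then A f x else B f x)"
    for f x by simp
  ultimately show ?thesis by simp
qed

section \<open>Arithmetic and Boolean operations\<close>

lemma computable_op_add:
  assumes "computable_op A" "computable_op B"
  shows "computable_op (\<lambda>f x. A f x + B f x)"
proof -
  have "computable_op (\<lambda>f x. rec_nat (A f x) (\<lambda>n r. Suc r) (B f x))"
    using assms by (intro computable_op_rec computable_op_Suc computable_op_psnd computable_op_id)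
  moreover have "rec_nat a (\<lambda>n r. Suc r) b = a + b" for a b by (induction b) auto
  ultimately show ?thesis by simp
qed

lemma computable_op_diff:
  assumes "computable_op A" "computable_op B"
  shows "computable_op (\<lambda>f x. A f x - B f x)"
proof -
  \<comment> \<open>The predecessor is the last counter value of a recursion; truncated subtraction
    iterates it.\<close>
  have pred: "computable_op (\<lambda>f x. rec_nat 0 (\<lambda>n r. n) (C f x))" if "computable_op C" for C
    using that by (intro computable_op_rec computable_op_pfst computable_op_psnd computable_op_id
        computable_op_const)
  have "computable_op (\<lambda>f x. rec_nat (A f x) (\<lambda>n r. rec_nat 0 (\<lambda>n r. n) r) (B f x))"
    using assms by (intro computable_op_rec pred computable_op_psnd computable_op_id)
  moreover have "rec_nat 0 (\<lambda>n r. n) c = c - 1" for c by (cases c) auto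
  moreover have "rec_nat a (\<lambda>n r. r - Suc 0) b = a - b" for a b by (induction b) auto
  ultimately show ?thesis by simp
qed

lemma decidable_op_nonzero:
  assumes "computable_op A"
  shows "decidable_op (\<lambda>f x. A f x \<noteq> 0)"
proof -
  have "computable_op (\<lambda>f x. 1 - (1 - A f x))"
    using assms by (intro computable_op_diff computable_op_const)
  moreover have "1 - (1 - a) = of_bool (a \<noteq> 0)" for a :: nat by auto
  ultimately show ?thesis unfolding decidable_op_def by simp
qed

lemma decidable_op_not:
  assumes "decidable_op P"
  shows "decidable_op (\<lambda>f x. \<not> P f x)"
proof -
  have "computable_op (\<lambda>f x. 1 - of_bool (P f x))"
    using assms unfolding decidable_op_def by (intro computable_op_diff computable_op_const)
  moreover have "of_bool (\<not> p) = 1 - (of_bool p :: nat)" for p by simp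
  ultimately show ?thesis unfolding decidable_op_def by simp
qed

lemma decidable_op_conj:
  assumes "decidable_op P" "decidable_op Q"
  shows "decidable_op (\<lambda>f x. P f x \<and> Q f x)"
proof -
  have "computable_op (\<lambda>f x. if P f x then of_bool (Q f x) else 0)"
    using assms by (intro computable_op_if computable_op_const) (auto simp: decidable_op_def)
  moreover have "(if p then of_bool q else 0) = (of_bool (p \<and> q) :: nat)" for p q by auto
  ultimately show ?thesis unfolding decidable_op_def by simp
qed

lemma decidable_op_disj:
  "decidable_op P \<Longrightarrow> decidable_op Q \<Longrightarrow> decidable_op (\<lambda>f x. P f x \<or> Q f x)"
  using decidable_op_not[OF decidable_op_conj[OF decidable_op_not decidable_op_not], of P Q] by simp

lemma decidable_op_imp:
  "decidable_op P \<Longrightarrow> decidable_op Q \<Longrightarrow> decidable_op (\<lambda>f x. P f x \<longrightarrow> Q f x)"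
  using decidable_op_disj[OF decidable_op_not, of P Q] by (simp only: imp_conv_disj)

lemma decidable_op_le:
  assumes "computable_op A" "computable_op B"
  shows "decidable_op (\<lambda>f x. A f x \<le> B f x)"
  using decidable_op_not[OF decidable_op_nonzero[OF computable_op_diff[OF assms]]] by simp

lemma decidable_op_less:
  assumes "computable_op A" "computable_op B"
  shows "decidable_op (\<lambda>f x. A f x < B f x)"
  using decidable_op_nonzero[OF computable_op_diff[OF assms(2,1)]] by (simp add: not_le)

lemma decidable_op_eq:
  assumes "computable_op A" "computable_op B"
  shows "decidable_op (\<lambda>f x. A f x = B f x)"
  using decidable_op_conj[OF decidable_op_le[OF assms] decidable_op_le[OF assms(2,1)]]
  by (simp only: order_eq_iff)

text \<open>\<open>mu_op\<close> looks for a zero, so it is run on the characteristic function of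
  the negation. That function is total, which makes the definedness clause of
  \<open>mu_stops\<close> automatic.\<close>

lemma turing_functional_search:
  assumes "decidable_op (\<lambda>f z. P f (pfst z) (psnd z))"
  shows "turing_functional (\<lambda>f x. if \<exists>n. P f x n then Some (LEAST n. P f x n) else None)"
proof -
  have "computable_op (\<lambda>f z. of_bool (\<not> P f (pfst z) (psnd z)))"
    using decidable_op_not[OF assms] by (simp add: decidable_op_def)
  from turing_functional.mu[OF this[unfolded computable_op_def]]
  moreover have "mu_stops (\<lambda>z. Some (of_bool (\<not> P f (pfst z) (psnd z)))) x = P f x" for f x
    by (simp add: mu_stops_def fun_eq_iff)
  ultimately show ?thesis unfolding mu_op_def[abs_def] by (simp only:)
qed

lemma computable_op_Least:
  assumes "decidable_op (\<lambda>f z. P f (pfst z) (psnd z))" "\<And>f x. \<exists>n. P f x n"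
  shows "computable_op (\<lambda>f x. LEAST n. P f x n)"
  using turing_functional_search[OF assms(1)] assms(2) by (simp add: computable_op_def)

lemma decidable_op_app:
  "decidable_op P \<Longrightarrow> computable_op A \<Longrightarrow> decidable_op (\<lambda>f x. P f (A f x))"
  unfolding decidable_op_def by (rule computable_op_app)

text \<open>The search also stops on reaching the bound, hence is total; a witness exists iff it
  stops strictly below the bound.\<close>

lemma decidable_op_bex:
  assumes P: "decidable_op (\<lambda>f z. P f (pfst z) (psnd z))" and N: "computable_op N"
  shows "decidable_op (\<lambda>f x. \<exists>k<N f x. P f x k)"
proof -
  have "computable_op (\<lambda>f x. LEAST k. N f x \<le> k \<or> P f x k)"
    by (intro computable_op_Least decidable_op_disj decidable_op_le computable_op_app[OF N]
        computable_op_pfst computable_op_psnd computable_op_id P) auto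
  then have "decidable_op (\<lambda>f x. (LEAST k. N f x \<le> k \<or> P f x k) < N f x)"
    using N by (intro decidable_op_less)
  moreover have "(LEAST k. n \<le> k \<or> Q k) < n \<longleftrightarrow> (\<exists>k<n. Q k)" for n :: nat and Q
    by (metis (mono_tags, lifting) LeastI Least_le le_less_trans linorder_not_less order.refl)
  ultimately show ?thesis by simp
qed

lemma decidable_op_ball:
  assumes "decidable_op (\<lambda>f z. P f (pfst z) (psnd z))" "computable_op N"
  shows "decidable_op (\<lambda>f x. \<forall>k<N f x. P f x k)"
  using decidable_op_not[OF decidable_op_bex[OF decidable_op_not[OF assms(1)] assms(2)]] by simp

lemmas computable_op_basic =
  computable_op_id computable_op_const computable_op_query computable_op_Suc computable_op_pfst
  computable_op_psnd computable_op_pair computable_op_if computable_op_add computable_op_diff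
  decidable_op_not decidable_op_conj decidable_op_disj decidable_op_imp decidable_op_le
  decidable_op_less decidable_op_eq decidable_op_bex decidable_op_ball

section \<open>Finite sets given by canonical indices\<close>

lemma computable_op_half:
  assumes "computable_op A"
  shows "computable_op (\<lambda>f x. A f x div 2)"
proof -
  have "computable_op (\<lambda>f x. LEAST k. x \<le> Suc (k + k))"
    by (intro computable_op_Least computable_op_basic) presburger
  moreover have "(LEAST k. n \<le> Suc (k + k)) = n div 2" for n :: nat
    by (rule Least_equality) auto
  ultimately have "computable_op (\<lambda>f x. x div 2)" by simp
  from computable_op_app[OF this assms] show ?thesis .
qed

lemma decidable_op_set_decode:
  assumes "computable_op A" "computable_op B"
  shows "decidable_op (\<lambda>f x. A f x \<in> set_decode (B f x))"
proof -
  have "computable_op (\<lambda>f x. rec_nat (B f x) (\<lambda>_ r. r div 2) (A f x))"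
    using assms by (intro computable_op_rec computable_op_half computable_op_basic)
  moreover have "rec_nat b (\<lambda>_ r. r div 2) a = b div 2 ^ a" for a b :: nat
    by (induction a) (simp_all add: power_Suc2 div_mult2_eq del: power_Suc)
  ultimately have C: "computable_op (\<lambda>f x. B f x div 2 ^ A f x)" by simp
  \<comment> \<open>Membership is oddness of the quotient, tested by comparing it with twice its
    half.\<close>
  have "decidable_op (\<lambda>f x. B f x div 2 ^ A f x \<noteq> (B f x div 2 ^ A f x) div 2 + (B f x div 2 ^ A f x) div 2)"
    by (intro computable_op_half computable_op_basic C)
  moreover have "odd c \<longleftrightarrow> c \<noteq> c div 2 + c div 2" for c :: nat by presburger
  ultimately show ?thesis by (simp add: set_decode_def)
qed

text \<open>This bound turns quantifiers over a canonical finite set into bounded numerical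
  quantifiers.\<close>

lemma set_decode_less:
  assumes "k \<in> set_decode u"
  shows "k < u"
proof -
  have "u div 2 ^ k \<noteq> 0" using assms by (auto simp: set_decode_def intro!: Nat.gr0I)
  then have "2 ^ k \<le> u" by (metis div_less linorder_not_less)
  then show ?thesis using less_exp[of k] by linarith
qed

lemma decidable_op_ball_set_decode:
  assumes "decidable_op (\<lambda>f z. P f (pfst z) (psnd z))" "computable_op U"
  shows "decidable_op (\<lambda>f x. \<forall>k\<in>set_decode (U f x). P f x k)"
proof -
  have "decidable_op (\<lambda>f x. \<forall>k<U f x. k \<in> set_decode (U f x) \<longrightarrow> P f x k)"
    by (intro computable_op_basic decidable_op_set_decode computable_op_app[OF assms(2)] assms)
  moreover have "(\<forall>k<u. k \<in> set_decode u \<longrightarrow> Q k) \<longleftrightarrow> (\<forall>k\<in>set_decode u. Q k)" for u Q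
    by (auto dest: set_decode_less)
  ultimately show ?thesis by simp
qed

lemma decidable_op_bex_set_decode:
  assumes "decidable_op (\<lambda>f z. P f (pfst z) (psnd z))" "computable_op U"
  shows "decidable_op (\<lambda>f x. \<exists>k\<in>set_decode (U f x). P f x k)"
  using decidable_op_not[OF decidable_op_ball_set_decode[OF decidable_op_not[OF assms(1)] assms(2)]]
  by simp

lemma decidable_op_set_decode_subset:
  assumes "computable_op U" "computable_op V"
  shows "decidable_op (\<lambda>f x. set_decode (U f x) \<subseteq> set_decode (V f x))"
  unfolding subset_eq
  by (intro decidable_op_ball_set_decode decidable_op_set_decode computable_op_basic assms
      computable_op_app[OF assms(2)])

section \<open>Finite prefixes of oracles\<close>

definition clen :: "nat \<Rightarrow> nat" where "clen u = length (list_decode u)"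
definition cnth :: "nat \<Rightarrow> nat \<Rightarrow> nat" where
  "cnth u i = (if i < clen u then list_decode u ! i else 0)"
definition prefix_code :: "(nat \<Rightarrow> nat) \<Rightarrow> nat \<Rightarrow> nat" where
  "prefix_code f m = list_encode (map f [0..<m])"

lemma clen_prefix_code [simp]: "clen (prefix_code f m) = m"
  by (simp add: clen_def prefix_code_def)

lemma cnth_prefix_code [simp]: "i < m \<Longrightarrow> cnth (prefix_code f m) i = f i"
  by (simp add: cnth_def clen_def prefix_code_def)

text \<open>List coding is a bijection, so an arbitrary number is a genuine prefix of some function
  and can be used as a stage.\<close>

lemma prefix_code_eqI:
  assumes "\<And>i. i < clen u \<Longrightarrow> f i = cnth u i"
  shows "prefix_code f (clen u) = u"
proof -
  have "map f [0..<clen u] = list_decode u"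
    using assms by (intro nth_equalityI) (auto simp: clen_def cnth_def)
  then show ?thesis by (simp add: prefix_code_def)
qed

text \<open>The code of a nonempty list is the successor of the paired head and tail code. The empty
  list has code 0, and \<open>psnd (0 - 1)\<close> is 0 again, so further tails stay empty.\<close>

lemma iterated_tail_code:
  "rec_nat u (\<lambda>_ r. psnd (r - 1)) i = list_encode (drop i (list_decode u))"
proof (induction i)
  case (Suc i)
  have "psnd (list_encode xs - 1) = list_encode (tl xs)" for xs
  proof (cases xs)
    case Nil
    have "prod_decode 0 = (0, 0)" using prod_encode_inverse[of "(0, 0)"] by (simp add: prod_encode_def)
    then show ?thesis using Nil by simp
  qed simp
  then show ?case using Suc by (simp add: drop_Suc drop_tl)
qed simp

lemma computable_op_clen:
  assumes "computable_op A"
  shows "computable_op (\<lambda>f x. clen (A f x))"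
proof -
  let ?d = "\<lambda>u i. rec_nat u (\<lambda>_ r. psnd (r - 1)) i"
  have len: "?d u i = 0 \<longleftrightarrow> clen u \<le> i" for u i
    unfolding iterated_tail_code clen_def
    by (metis drop_eq_Nil list_encode.simps(1) list_encode_eq)
  \<comment> \<open>The length is the number of tails taken until the list is empty.\<close>
  have "computable_op (\<lambda>f x. LEAST i. ?d x i = 0)"
    by (intro computable_op_Least computable_op_rec computable_op_basic) (auto simp only: len)
  moreover have "(LEAST i. ?d u i = 0) = clen u" for u
    unfolding len by (rule Least_equality) auto
  ultimately have "computable_op (\<lambda>f x. clen x)" by simp
  from computable_op_app[OF this assms] show ?thesis .
qed

lemma computable_op_cnth:
  assumes "computable_op A" "computable_op B"
  shows "computable_op (\<lambda>f x. cnth (A f x) (B f x))"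
proof -
  let ?d = "\<lambda>u i. rec_nat u (\<lambda>_ r. psnd (r - 1)) i"
  have "computable_op (\<lambda>f x. if B f x < clen (A f x) then pfst (?d (A f x) (B f x) - 1) else 0)"
    by (intro computable_op_basic computable_op_clen computable_op_rec assms)
  moreover have "(if i < clen u then pfst (?d u i - 1) else 0) = cnth u i" for u i
    unfolding iterated_tail_code
    by (auto simp: cnth_def clen_def simp flip: Cons_nth_drop_Suc)
  ultimately show ?thesis by simp
qed

lemmas computable_op_rules = computable_op_basic computable_op_clen computable_op_cnth
  decidable_op_set_decode decidable_op_ball_set_decode decidable_op_bex_set_decode
  decidable_op_set_decode_subset

section \<open>Finite approximations of Turing functionals\<close>

text \<open>A prefix serves both as a finite part of the oracle and, through its length, as a time bound.\<close>

definition stage_approx ::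
    "((nat \<Rightarrow> nat) \<Rightarrow> (nat \<rightharpoonup> nat)) \<Rightarrow> (nat \<Rightarrow> nat \<Rightarrow> nat) \<Rightarrow> bool" where
  "stage_approx F h \<longleftrightarrow> computable_op (\<lambda>_ z. h (pfst z) (psnd z)) \<and>
     (\<forall>f m x y. h (prefix_code f m) x = Suc y \<longrightarrow> F f x = Some y) \<and>
     (\<forall>f x y. F f x = Some y \<longrightarrow> (\<forall>\<^sub>F m in sequentially. h (prefix_code f m) x = Suc y))"

lemma stage_approx_computable:
  assumes "stage_approx F h" "computable_op A" "computable_op B"
  shows "computable_op (\<lambda>f x. h (A f x) (B f x))"
  using computable_op_app[OF _ computable_op_pair[OF assms(2,3)], of "\<lambda>_ z. h (pfst z) (psnd z)"]
    assms(1) by (simp add: stage_approx_def)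

lemma stage_approx_sound:
  "stage_approx F h \<Longrightarrow> h (prefix_code f m) x = Suc y \<Longrightarrow> F f x = Some y"
  by (auto simp: stage_approx_def)

lemma stage_approx_complete:
  "stage_approx F h \<Longrightarrow> F f x = Some y \<Longrightarrow> \<forall>\<^sub>F m in sequentially. h (prefix_code f m) x = Suc y"
  by (auto simp: stage_approx_def)

section \<open>Approximations for each way of building a functional\<close>

lemma stage_approx_total:
  assumes "computable_op (\<lambda>_. g)"
  shows "\<exists>h. stage_approx (\<lambda>_ x. Some (g x)) h"
  by (intro exI[of _ "\<lambda>u x. Suc (g x)"])
    (auto simp: stage_approx_def intro!: computable_op_rules computable_op_app[OF assms])

lemma stage_approx_query: "\<exists>h. stage_approx (\<lambda>f x. Some (f x)) h"
proof (intro exI[of _ "\<lambda>u x. if x < clen u then Suc (cnth u x) else 0"])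
  have "computable_op (\<lambda>_ z. if psnd z < clen (pfst z) then Suc (cnth (pfst z) (psnd z)) else 0)"
    by (intro computable_op_rules)
  moreover have "\<forall>\<^sub>F m in sequentially. x < m" for x :: nat
    by (rule eventually_gt_at_top)
  ultimately show "stage_approx (\<lambda>f x. Some (f x)) (\<lambda>u x. if x < clen u then Suc (cnth u x) else 0)"
    by (auto simp: stage_approx_def split: if_splits elim!: eventually_mono)
qed

text \<open>The value 0 means that no output is known yet, \<open>Suc y\<close> announces the output
  y. Completeness concerns all sufficiently long prefixes, so both outputs can be awaited at a
  common stage.\<close>

lemma stage_approx_pair:
  assumes "stage_approx F h" "stage_approx G k"
  shows "\<exists>j. stage_approx (\<lambda>f. pair_op (F f) (G f)) j"
proof
  let ?j = "\<lambda>u x. if h u x \<noteq> 0 \<and> k u x \<noteq> 0 then Suc (prod_encode (h u x - 1, k u x - 1)) else 0"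
  show "stage_approx (\<lambda>f. pair_op (F f) (G f)) ?j"
    unfolding stage_approx_def
  proof (intro conjI allI impI)
    show "computable_op (\<lambda>_ z. ?j (pfst z) (psnd z))"
      by (intro computable_op_rules assms[THEN stage_approx_computable])
  next
    fix f m x y
    assume "?j (prefix_code f m) x = Suc y"
    then obtain a b where ab: "h (prefix_code f m) x = Suc a" "k (prefix_code f m) x = Suc b"
        "y = prod_encode (a, b)"
      by (cases "h (prefix_code f m) x"; cases "k (prefix_code f m) x") auto
    show "pair_op (F f) (G f) x = Some y"
      using stage_approx_sound[OF assms(1), OF ab(1)] stage_approx_sound[OF assms(2), OF ab(2)] ab(3)
      by (simp add: pair_op_def)
  next
    fix f x y
    assume "pair_op (F f) (G f) x = Some y"
    then obtain a b where ab: "F f x = Some a" "G f x = Some b" and y: "y = prod_encode (a, b)"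
      by (auto simp: pair_op_def bind_eq_Some_conv)
    show "\<forall>\<^sub>F m in sequentially. ?j (prefix_code f m) x = Suc y"
      using stage_approx_complete[OF assms(1), OF ab(1)] stage_approx_complete[OF assms(2), OF ab(2)]
      by eventually_elim (simp add: y)
  qed
qed

lemma stage_approx_comp:
  assumes "stage_approx F h" "stage_approx G k"
  shows "\<exists>j. stage_approx (\<lambda>f. F f \<circ>\<^sub>m G f) j"
proof
  let ?j = "\<lambda>u x. if k u x \<noteq> 0 then h u (k u x - 1) else 0"
  show "stage_approx (\<lambda>f. F f \<circ>\<^sub>m G f) ?j"
    unfolding stage_approx_def
  proof (intro conjI allI impI)
    show "computable_op (\<lambda>_ z. ?j (pfst z) (psnd z))"
      by (intro computable_op_rules assms[THEN stage_approx_computable])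
  next
    fix f m x y
    assume "?j (prefix_code f m) x = Suc y"
    then obtain a where a: "k (prefix_code f m) x = Suc a" "h (prefix_code f m) a = Suc y"
      by (cases "k (prefix_code f m) x") auto
    show "(F f \<circ>\<^sub>m G f) x = Some y"
      using stage_approx_sound[OF assms(1), OF a(2)] stage_approx_sound[OF assms(2), OF a(1)]
      by (simp add: map_comp_def)
  next
    fix f x y
    assume "(F f \<circ>\<^sub>m G f) x = Some y"
    then obtain a where a: "F f a = Some y" "G f x = Some a"
      by (auto simp: map_comp_Some_iff)
    show "\<forall>\<^sub>F m in sequentially. ?j (prefix_code f m) x = Suc y"
      using stage_approx_complete[OF assms(1), OF a(1)] stage_approx_complete[OF assms(2), OF a(2)]
      by eventually_elim simp
  qed
qed

text \<open>The counterpart of \<open>rec_value\<close> at a fixed stage: an unknown intermediate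
  value, coded 0, is passed on to the end.\<close>

primrec stage_rec :: "(nat \<Rightarrow> nat \<Rightarrow> nat) \<Rightarrow> (nat \<Rightarrow> nat \<Rightarrow> nat) \<Rightarrow> nat \<Rightarrow> nat \<Rightarrow> nat \<Rightarrow> nat" where
  "stage_rec h k u a 0 = h u a"
| "stage_rec h k u a (Suc n) =
     (case stage_rec h k u a n of 0 \<Rightarrow> 0 | Suc r \<Rightarrow> k u (prod_encode (a, prod_encode (n, r))))"

lemma stage_rec_eq_rec_nat:
  "stage_rec h k u a n = rec_nat (h u a)
     (\<lambda>n r. if r = 0 then 0 else k u (prod_encode (a, prod_encode (n, r - 1)))) n"
proof (induction n)
  case (Suc n)
  then show ?case by (cases "stage_rec h k u a n") (simp_all split: nat.split)
qed simp

lemma stage_approx_prec: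
  assumes "stage_approx F h" "stage_approx G k"
  shows "\<exists>j. stage_approx (\<lambda>f. primrec_op (F f) (G f)) j"
proof
  let ?r = "stage_rec h k"
  let ?j = "\<lambda>u x. ?r u (pfst x) (psnd x)"
  show "stage_approx (\<lambda>f. primrec_op (F f) (G f)) ?j"
    unfolding stage_approx_def
  proof (intro conjI allI impI)
    show "computable_op (\<lambda>_ z. ?j (pfst z) (psnd z))"
      unfolding stage_rec_eq_rec_nat
      by (intro computable_op_rec computable_op_rules assms[THEN stage_approx_computable])
  next
    fix f m x y
    have sound: "?r (prefix_code f m) a n = Suc y \<Longrightarrow> rec_value (F f) (G f) a n = Some y" for a n y
    proof (induction n arbitrary: y)
      case 0
      then show ?case by (simp add: stage_approx_sound[OF assms(1), of f m])
    next
      case (Suc n)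
      then obtain b where b: "?r (prefix_code f m) a n = Suc b"
        by (cases "?r (prefix_code f m) a n") auto
      then have "k (prefix_code f m) (prod_encode (a, prod_encode (n, b))) = Suc y"
        using Suc.prems by simp
      from stage_approx_sound[OF assms(2), OF this] show ?case using Suc.IH[OF b] by simp
    qed
    assume "?j (prefix_code f m) x = Suc y"
    from sound[OF this] show "primrec_op (F f) (G f) x = Some y"
      by (simp add: primrec_op_def case_prod_unfold)
  next
    fix f x y
    have complete: "rec_value (F f) (G f) a n = Some y \<Longrightarrow>
        \<forall>\<^sub>F m in sequentially. ?r (prefix_code f m) a n = Suc y" for a n y
    proof (induction n arbitrary: y)
      case 0
      then have "F f a = Some y" by simp
      from stage_approx_complete[OF assms(1), OF this] show ?case by simp
    next
      case (Suc n)
      then obtain b where b: "rec_value (F f) (G f) a n = Some b"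
          "G f (prod_encode (a, prod_encode (n, b))) = Some y"
        by (auto simp: bind_eq_Some_conv)
      show ?case
        using eventually_conj[OF Suc.IH[OF b(1)] stage_approx_complete[OF assms(2), OF b(2)]]
        by (rule eventually_mono) simp
    qed
    assume "primrec_op (F f) (G f) x = Some y"
    then show "\<forall>\<^sub>F m in sequentially. ?j (prefix_code f m) x = Suc y"
      by (intro complete) (simp add: primrec_op_def case_prod_unfold)
  qed
qed

text \<open>Before the stopping point every value is defined, and a value 0 there would have stopped
  the search earlier. This form avoids \<open>LEAST\<close>.\<close>

lemma mu_op_eq_Some_iff:
  "mu_op p x = Some k \<longleftrightarrow>
     p (prod_encode (x, k)) = Some 0 \<and> (\<forall>j<k. \<exists>v. p (prod_encode (x, j)) = Some (Suc v))"
  (is "?L \<longleftrightarrow> ?R")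
proof
  assume ?L
  then have "\<exists>n. mu_stops p x n" and k: "k = (LEAST n. mu_stops p x n)"
    by (auto simp: mu_op_def split: if_splits)
  then have stop: "mu_stops p x k" by (metis LeastI)
  have "\<exists>v. p (prod_encode (x, j)) = Some (Suc v)" if j: "j < k" for j
  proof -
    have "\<not> mu_stops p x j" using j k not_less_Least by blast
    moreover obtain w where "p (prod_encode (x, j)) = Some w"
      using stop j by (auto simp: mu_stops_def)
    moreover have "\<forall>i<j. p (prod_encode (x, i)) \<noteq> None"
      using stop j by (auto simp: mu_stops_def)
    ultimately show ?thesis by (cases w) (auto simp: mu_stops_def)
  qed
  then show ?R using stop by (simp add: mu_stops_def)
next
  assume R: ?R
  then have stop: "mu_stops p x k" by (auto simp: mu_stops_def)
  moreover have "(LEAST n. mu_stops p x n) = k"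
  proof (rule Least_equality)
    fix n assume "mu_stops p x n"
    then have "\<not> n < k" using R by (auto simp: mu_stops_def)
    then show "k \<le> n" by simp
  qed (rule stop)
  ultimately show ?L by (auto simp: mu_op_def)
qed

lemma stage_approx_mu:
  assumes "stage_approx F h"
  shows "\<exists>j. stage_approx (\<lambda>f. mu_op (F f)) j"
proof
  \<comment> \<open>The search halts at the first argument whose value is unknown (0) or known to be
    zero (1), or at the length of the prefix. An output is given only in the second case; all
    earlier values are then known and nonzero.\<close>
  let ?l = "\<lambda>u x. LEAST i. clen u \<le> i \<or> h u (prod_encode (x, i)) \<le> 1"
  let ?j = "\<lambda>u x. if h u (prod_encode (x, ?l u x)) = 1 then Suc (?l u x) else 0"
  show "stage_approx (\<lambda>f. mu_op (F f)) ?j"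
    unfolding stage_approx_def
  proof (intro conjI allI impI)
    have "computable_op (\<lambda>_ z. ?l (pfst z) (psnd z))"
      by (intro computable_op_Least computable_op_rules stage_approx_computable[OF assms]) auto
    then show "computable_op (\<lambda>_ z. ?j (pfst z) (psnd z))"
      by (intro computable_op_rules stage_approx_computable[OF assms])
  next
    fix f m x y
    let ?u = "prefix_code f m"
    assume "?j ?u x = Suc y"
    then have y: "y = ?l ?u x" and 1: "h ?u (prod_encode (x, y)) = Suc 0"
      by (auto split: if_splits)
    have "\<exists>v. F f (prod_encode (x, i)) = Some (Suc v)" if "i < y" for i
    proof -
      have "\<not> h ?u (prod_encode (x, i)) \<le> 1"
        using that not_less_Least unfolding y by blast
      then obtain v where "h ?u (prod_encode (x, i)) = Suc (Suc v)"
        by (metis One_nat_def not_less_eq_eq le0 not0_implies_Suc)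
      then show ?thesis using stage_approx_sound[OF assms] by blast
    qed
    then show "mu_op (F f) x = Some y"
      using stage_approx_sound[OF assms, OF 1] by (simp add: mu_op_eq_Some_iff)
  next
    fix f x y
    assume "mu_op (F f) x = Some y"
    then have y: "F f (prod_encode (x, y)) = Some 0"
        and lt: "\<And>i. i < y \<Longrightarrow> \<exists>v. F f (prod_encode (x, i)) = Some (Suc v)"
      by (auto simp: mu_op_eq_Some_iff)
    have "\<forall>\<^sub>F m in sequentially. h (prefix_code f m) (prod_encode (x, i)) > 1" if "i < y" for i
      using lt[OF that] by (auto dest!: stage_approx_complete[OF assms] elim: eventually_mono)
    then have "\<forall>\<^sub>F m in sequentially. \<forall>i\<in>{..<y}. h (prefix_code f m) (prod_encode (x, i)) > 1"
      by (intro eventually_ball_finite) auto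
    \<comment> \<open>Eventually all values up to \<open>y\<close> are known, and
      \<open>y < m\<close> ensures that the length bound does not stop the search too early.\<close>
    from eventually_conj[OF this eventually_conj[OF stage_approx_complete[OF assms, OF y]
          eventually_gt_at_top[of y]]]
    show "\<forall>\<^sub>F m in sequentially. ?j (prefix_code f m) x = Suc y"
    proof (rule eventually_mono)
      fix m
      assume elim: "(\<forall>i\<in>{..<y}. h (prefix_code f m) (prod_encode (x, i)) > 1) \<and>
        h (prefix_code f m) (prod_encode (x, y)) = Suc 0 \<and> y < m"
      have "?l (prefix_code f m) x = y"
      proof (rule Least_equality)
        fix i assume "clen (prefix_code f m) \<le> i \<or> h (prefix_code f m) (prod_encode (x, i)) \<le> 1"
        then have "\<not> i < y" using elim by (auto dest!: bspec[of _ _ i])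
        then show "y \<le> i" by simp
      qed (use elim in simp)
      then show "?j (prefix_code f m) x = Suc y" using elim by simp
    qed
  qed
qed

lemma partial_recursive_stage_approx:
  "partial_recursive p \<Longrightarrow> \<exists>h. stage_approx (\<lambda>_. p) h"
proof (induction rule: partial_recursive.induct)
  case (pair p q)
  then show ?case using stage_approx_pair by fast
next
  case (comp p q)
  then show ?case using stage_approx_comp by fast
next
  case (prec p q)
  then show ?case using stage_approx_prec by fast
next
  case (mu p)
  then show ?case using stage_approx_mu by fast
qed (rule stage_approx_total, rule computable_op_const computable_op_Suc[OF computable_op_id]
    computable_op_pfst[OF computable_op_id] computable_op_psnd[OF computable_op_id])+

theorem turing_functional_stage_approx:
  "turing_functional F \<Longrightarrow> \<exists>h. stage_approx F h"
proof (induction rule: turing_functional.induct)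
  case query
  show ?case by (rule stage_approx_query)
next
  case (oracle_free p)
  then show ?case by (rule partial_recursive_stage_approx)
next
  case (pair F G)
  then show ?case using stage_approx_pair by fast
next
  case (comp F G)
  then show ?case using stage_approx_comp by fast
next
  case (prec F G)
  then show ?case using stage_approx_prec by fast
next
  case (mu F)
  then show ?case using stage_approx_mu by fast
qed

section \<open>Enumeration reducibility\<close>

definition decidable3 :: "(nat \<Rightarrow> nat \<Rightarrow> nat \<Rightarrow> bool) \<Rightarrow> bool" where
  "decidable3 R \<longleftrightarrow> decidable_op (\<lambda>_ z. R (pfst z) (pfst (psnd z)) (psnd (psnd z)))"

lemma decidable3_app:
  assumes "decidable3 R" "computable_op A" "computable_op B" "computable_op C"
  shows "decidable_op (\<lambda>f x. R (A f x) (B f x) (C f x))"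
  using decidable_op_app[OF assms(1)[unfolded decidable3_def]
      computable_op_pair[OF assms(2) computable_op_pair[OF assms(3,4)]]] by simp

text \<open>A normal form: the enumerable set of axioms is the projection of a decidable relation,
  with \<open>s\<close> as the stage at which an axiom is confirmed.\<close>

lemma enum_reducible_iff:
  "enum_reducible A B \<longleftrightarrow>
     (\<exists>R. decidable3 R \<and> A = {n. \<exists>u s. R n u s \<and> set_decode u \<subseteq> B})" (is "?L \<longleftrightarrow> ?R")
proof
  assume ?L
  then obtain p where p: "partial_recursive p"
      and A: "A = {n. \<exists>u. prod_encode (n, u) \<in> dom p \<and> set_decode u \<subseteq> B}"
    by (auto simp: enum_reducible_def comp_enumerable_def)
  obtain h where h: "stage_approx (\<lambda>_. p) h"
    using partial_recursive_stage_approx[OF p] by blast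
  have dom: "x \<in> dom p \<longleftrightarrow> (\<exists>s. h s x \<noteq> 0)" for x
  proof
    assume "x \<in> dom p"
    then obtain y where "p x = Some y" by auto
    then obtain m where "h (prefix_code (\<lambda>_. 0) m) x = Suc y"
      using eventually_happens'[OF sequentially_bot stage_approx_complete[OF h]] by blast
    then show "\<exists>s. h s x \<noteq> 0" by (metis nat.distinct(2))
  next
    assume "\<exists>s. h s x \<noteq> 0"
    then obtain s y where "h s x = Suc y" using not0_implies_Suc by blast
    \<comment> \<open>Soundness speaks only of prefix codes; every number is one.\<close>
    moreover have "s = prefix_code (cnth s) (clen s)" by (simp add: prefix_code_eqI)
    ultimately show "x \<in> dom p" using stage_approx_sound[OF h] by (metis domI)
  qed
  have "decidable3 (\<lambda>n u s. h s (prod_encode (n, u)) \<noteq> 0)"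
    unfolding decidable3_def by (intro computable_op_rules stage_approx_computable[OF h])
  then show ?R unfolding A dom by blast
next
  assume ?R
  then obtain R where R: "decidable3 R" and A: "A = {n. \<exists>u s. R n u s \<and> set_decode u \<subseteq> B}"
    by blast
  \<comment> \<open>The search for a stage halts exactly on the confirmed axioms, so its domain is
    the required enumerable set.\<close>
  have "decidable_op (\<lambda>_ z. R (pfst (pfst z)) (psnd (pfst z)) (psnd z))"
    by (intro decidable3_app[OF R] computable_op_rules)
  note search = turing_functional_zero_oracle[OF turing_functional_search[OF this]]
  have "comp_enumerable {x. \<exists>s. R (pfst x) (psnd x) s}"
    unfolding comp_enumerable_def by (intro exI conjI, rule search) (auto simp: dom_def)
  then show ?L unfolding enum_reducible_def A by (intro exI[of _ "{x. \<exists>s. R (pfst x) (psnd x) s}"]) auto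
qed

lemma enum_reducibleI:
  "decidable3 R \<Longrightarrow> (\<And>n. n \<in> A \<longleftrightarrow> (\<exists>u s. R n u s \<and> set_decode u \<subseteq> B)) \<Longrightarrow> enum_reducible A B"
  unfolding enum_reducible_iff by blast

lemma enum_reducibleE:
  assumes "enum_reducible A B"
  obtains R where "decidable3 R" "\<And>n. n \<in> A \<longleftrightarrow> (\<exists>u s. R n u s \<and> set_decode u \<subseteq> B)"
  using assms unfolding enum_reducible_iff by blast

text \<open>Axioms are composed. In \<open>?T\<close>, \<open>x\<close> codes an axiom u for
  \<open>R\<close>, its stage, and a bound on the axioms and stages of \<open>Q\<close> for the
  elements of u; the bound keeps the condition decidable.\<close>

lemma enum_reducible_trans:
  assumes "enum_reducible A B" "enum_reducible B C"
  shows "enum_reducible A C"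
proof -
  obtain R where R: "decidable3 R" and A: "\<And>n. n \<in> A \<longleftrightarrow> (\<exists>u s. R n u s \<and> set_decode u \<subseteq> B)"
    using enum_reducibleE[OF assms(1)] by blast
  obtain Q where Q: "decidable3 Q" and B: "\<And>n. n \<in> B \<longleftrightarrow> (\<exists>u s. Q n u s \<and> set_decode u \<subseteq> C)"
    using enum_reducibleE[OF assms(2)] by blast
  let ?T = "\<lambda>n w x. R n (pfst x) (pfst (psnd x)) \<and> (\<forall>k\<in>set_decode (pfst x).
      \<exists>v<psnd (psnd x). \<exists>s<psnd (psnd x). Q k v s \<and> set_decode v \<subseteq> set_decode w)"
  show ?thesis
  proof (rule enum_reducibleI)
    show "decidable3 ?T"
      unfolding decidable3_def
      by (intro computable_op_rules decidable3_app[OF R] decidable3_app[OF Q])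
  next
    fix n
    show "n \<in> A \<longleftrightarrow> (\<exists>w x. ?T n w x \<and> set_decode w \<subseteq> C)"
    proof
      assume "n \<in> A"
      then obtain u s where us: "R n u s" "set_decode u \<subseteq> B" using A by blast
      then have "\<forall>k\<in>set_decode u. \<exists>v s. Q k v s \<and> set_decode v \<subseteq> C" using B by blast
      then obtain V S where VS: "\<And>k. k \<in> set_decode u \<Longrightarrow> Q k (V k) (S k) \<and> set_decode (V k) \<subseteq> C"
        by metis
      \<comment> \<open>The premise of the composed axiom is the union of all premises used for
        elements of \<open>u\<close>.\<close>
      let ?w = "set_encode (\<Union>k\<in>set_decode u. set_decode (V k))"
      have w: "set_decode ?w = (\<Union>k\<in>set_decode u. set_decode (V k))"
        by (intro set_encode_inverse) auto
      define t where "t = Suc (\<Sum>k\<in>set_decode u. V k + S k)"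
      have t: "V k < t" "S k < t" if "k \<in> set_decode u" for k
        using member_le_sum[OF that, of "\<lambda>k. V k + S k"] unfolding t_def by auto
      have "?T n ?w (prod_encode (u, prod_encode (s, t)))"
        using us(1) VS t unfolding w prod_encode_inverse fst_conv snd_conv by blast
      moreover have "set_decode ?w \<subseteq> C" unfolding w using VS by blast
      ultimately show "\<exists>w x. ?T n w x \<and> set_decode w \<subseteq> C" by blast
    next
      assume "\<exists>w x. ?T n w x \<and> set_decode w \<subseteq> C"
      then obtain w x where wx: "?T n w x" "set_decode w \<subseteq> C" by blast
      then have "set_decode (pfst x) \<subseteq> B" using B by (meson order_trans subsetI)
      then show "n \<in> A" using wx(1) A by blast
    qed
  qed
qed

section \<open>Cototal degrees are compact\<close>

text \<open>Unlike \<^const>\<open>enumerations\<close>, this class is also nonempty for the empty set.\<close>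

definition lazy_enumerations :: "nat set \<Rightarrow> (nat \<Rightarrow> nat) set" where
  "lazy_enumerations B = {f. \<forall>k. Suc k \<in> range f \<longleftrightarrow> k \<in> B}"

lemma finite_subset_range_bounded:
  fixes f :: "nat \<Rightarrow> 'a"
  assumes "finite S" "S \<subseteq> range f"
  shows "\<exists>t. \<forall>k\<in>S. \<exists>i<t. f i = k"
proof -
  obtain C where "finite C" "S = f ` C"
    using finite_subset_image[of S f UNIV] assms by auto
  then have "\<forall>k\<in>S. \<exists>i<Suc (Max C). f i = k" by (auto simp: less_Suc_eq_le intro: Max_ge)
  then show ?thesis by blast
qed

lemma computable_op_medvedev_reducible:
  assumes "computable_op G" "\<And>f. f \<in> Q \<Longrightarrow> G f \<in> P"
  shows "medvedev_reducible P Q"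
  using assms unfolding medvedev_reducible_def computable_op_def by blast

text \<open>Each position of the output codes a candidate \<open>n\<close>, an axiom, a stage and a
  length of \<open>f\<close>. The candidate is printed if the first \<open>t\<close> values of
  \<open>f\<close> verify the axiom; otherwise a fixed element \<open>a\<close> of \<open>A\<close>
  fills the position.\<close>

lemma enumerations_reducible_lazy_enumerations:
  assumes "enum_reducible A B" "A \<noteq> {}"
  shows "medvedev_reducible (enumerations A) (lazy_enumerations B)"
proof -
  obtain R where R: "decidable3 R" and A: "\<And>n. n \<in> A \<longleftrightarrow> (\<exists>u s. R n u s \<and> set_decode u \<subseteq> B)"
    using enum_reducibleE[OF assms(1)] by blast
  obtain a where a: "a \<in> A" using assms(2) by blast
  let ?P = "\<lambda>f n u s t. R n u s \<and> (\<forall>k\<in>set_decode u. \<exists>i<t. f i = Suc k)"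
  let ?G = "\<lambda>f x. if ?P f (pfst x) (pfst (psnd x)) (pfst (psnd (psnd x))) (psnd (psnd (psnd x)))
    then pfst x else a"
  have "computable_op ?G"
    by (intro computable_op_rules decidable3_app[OF R])
  moreover have "range (?G f) = A" if f: "f \<in> lazy_enumerations B" for f
  proof (intro equalityI subsetI)
    fix n assume "n \<in> range (?G f)"
    moreover have "n \<in> A" if P: "?P f n u s t" for u s t
    proof -
      have "set_decode u \<subseteq> B"
      proof
        fix k assume "k \<in> set_decode u"
        then obtain i where "f i = Suc k" using P by blast
        then have "Suc k \<in> range f" by (metis rangeI)
        then show "k \<in> B" using f by (simp add: lazy_enumerations_def)
      qed
      then show ?thesis using A P by blast
    qed
    ultimately show "n \<in> A" using a by (auto split: if_splits)
  next
    fix n assume "n \<in> A"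
    then obtain u s where us: "R n u s" "set_decode u \<subseteq> B" using A by blast
    then have "Suc ` set_decode u \<subseteq> range f"
      using f by (auto simp: lazy_enumerations_def)
    then obtain t where "\<forall>k\<in>set_decode u. \<exists>i<t. f i = Suc k"
      using finite_subset_range_bounded[of "Suc ` set_decode u" f] by auto
    then have "?G f (prod_encode (n, prod_encode (u, prod_encode (s, t)))) = n"
      using us(1) by simp
    then show "n \<in> range (?G f)" by (rule range_eqI[OF sym])
  qed
  ultimately show ?thesis
    by (intro computable_op_medvedev_reducible[of ?G]) (simp_all only: enumerations_def mem_Collect_eq)
qed

text \<open>An axiom \<^term>\<open>(n, u)\<close> of an operator enumerating \<^term>\<open>B\<close> from its complement
  guarantees that \<^term>\<open>B\<close> meets \<^term>\<open>insert n (set_decode u)\<close>. A choice of one such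
  element per axiom enumerates \<^term>\<open>B\<close>, because \<^term>\<open>n\<close> is the only option when
  the axiom applies.\<close>

definition axiom_choices :: "(nat \<Rightarrow> nat \<Rightarrow> nat \<Rightarrow> bool) \<Rightarrow> nat set \<Rightarrow> nat \<Rightarrow> nat set" where
  "axiom_choices R B z =
     (if R (pfst z) (pfst (psnd z)) (psnd (psnd z))
      then Suc ` (B \<inter> insert (pfst z) (set_decode (pfst (psnd z)))) else {0})"

text \<open>Tychonoff's theorem for finite, hence compact, factors.\<close>

lemma compact_PiE_finite:
  fixes S :: "nat \<Rightarrow> nat set"
  assumes "\<And>i. finite (S i)"
  shows "compact (PiE UNIV S)"
proof -
  have "compactin (product_topology (\<lambda>i. euclidean) UNIV) (PiE UNIV S)"
    unfolding compactin_PiE using assms by (auto intro: finite_imp_compact)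
  then show ?thesis by (simp add: euclidean_product_topology)
qed

lemma compact_axiom_choices: "compact (PiE UNIV (axiom_choices R B))"
  by (rule compact_PiE_finite) (simp add: axiom_choices_def)

lemma axiom_choices_lazy_enumerations:
  assumes B: "\<And>n. n \<in> B \<longleftrightarrow> (\<exists>u s. R n u s \<and> set_decode u \<subseteq> - B)"
  shows "PiE UNIV (axiom_choices R B) \<subseteq> lazy_enumerations B"
proof
  fix f assume "f \<in> PiE UNIV (axiom_choices R B)"
  then have f: "\<And>z. f z \<in> axiom_choices R B z" by auto
  have "k \<in> B" if k: "Suc k \<in> range f" for k
  proof -
    obtain z where "f z = Suc k" using k by (metis rangeE)
    then have "Suc k \<in> axiom_choices R B z" using f by metis
    then show ?thesis by (auto simp: axiom_choices_def split: if_splits)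
  qed
  moreover have "Suc k \<in> range f" if k: "k \<in> B" for k
  proof -
    obtain u s where us: "R k u s" "set_decode u \<subseteq> - B" using B k by blast
    \<comment> \<open>As \<open>set_decode u\<close> misses \<open>B\<close>, the set of choices at
      this axiom is the singleton of \<open>Suc k\<close>.\<close>
    have "f (prod_encode (k, prod_encode (u, s))) = Suc k"
      using f[of "prod_encode (k, prod_encode (u, s))"] us by (auto simp: axiom_choices_def)
    then show ?thesis by (metis rangeI)
  qed
  ultimately show "f \<in> lazy_enumerations B" by (auto simp: lazy_enumerations_def)
qed

text \<open>For each valid axiom one searches for an element of its finite set together with a
  proof, from finitely many values of \<open>f\<close>, that it lies in \<open>B\<close>.\<close>

lemma axiom_choices_reducible_enumerations:
  assumes R: "decidable3 R"
    and B: "\<And>n. n \<in> B \<longleftrightarrow> (\<exists>u s. R n u s \<and> set_decode u \<subseteq> - B)"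
    and BA: "enum_reducible B A"
  shows "medvedev_reducible (PiE UNIV (axiom_choices R B)) (enumerations A)"
proof -
  obtain Q where Q: "decidable3 Q" and BQ: "\<And>n. n \<in> B \<longleftrightarrow> (\<exists>u s. Q n u s \<and> set_decode u \<subseteq> A)"
    using enum_reducibleE[OF BA] by blast
  let ?R = "\<lambda>z. R (pfst z) (pfst (psnd z)) (psnd (psnd z))"
  let ?T = "\<lambda>f z k v s t. (k = pfst z \<or> k \<in> set_decode (pfst (psnd z))) \<and> Q k v s \<and>
    (\<forall>j\<in>set_decode v. \<exists>i<t. f i = j)"
  \<comment> \<open>The witness \<open>w\<close> codes the chosen element, a \<open>Q\<close>-axiom
    for it, a stage, and a number of values of \<open>f\<close>. For invalid \<open>z\<close> any
    witness is accepted, and \<open>?g\<close> returns 0.\<close>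
  let ?P = "\<lambda>f z w. ?R z \<longrightarrow>
    ?T f z (pfst w) (pfst (psnd w)) (pfst (psnd (psnd w))) (psnd (psnd (psnd w)))"
  let ?S = "\<lambda>f z. if \<exists>w. ?P f z w then Some (LEAST w. ?P f z w) else None"
  let ?g = "\<lambda>x. if ?R (pfst x) then Suc (pfst (psnd x)) else 0"
  have "decidable_op (\<lambda>f z. ?P f (pfst z) (psnd z))"
    by (intro computable_op_rules decidable3_app[OF R] decidable3_app[OF Q])
  then have S: "turing_functional ?S" by (rule turing_functional_search)
  have "computable_op (\<lambda>_. ?g)"
    by (intro computable_op_rules decidable3_app[OF R])
  then have g: "turing_functional (\<lambda>_ x. Some (?g x))" by (simp add: computable_op_def)
  have id: "turing_functional (\<lambda>_ x. Some x)"
    using computable_op_id by (simp add: computable_op_def)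
  let ?F = "\<lambda>f. (\<lambda>x. Some (?g x)) \<circ>\<^sub>m pair_op Some (?S f)"
  have F: "turing_functional ?F"
    using turing_functional.comp[OF g turing_functional.pair[OF id S]] by simp
  have "\<exists>g\<in>PiE UNIV (axiom_choices R B). \<forall>z. ?F f z = Some (g z)" if f: "f \<in> enumerations A" for f
  proof -
    have range: "range f = A" using f by (simp add: enumerations_def)
    have ex: "\<exists>w. ?P f z w" for z
    proof (cases "?R z")
      case True
      \<comment> \<open>If \<open>B\<close> misses the premise, the axiom applies and puts
        \<open>pfst z\<close> into \<open>B\<close>.\<close>
      have "\<exists>k\<in>B. k = pfst z \<or> k \<in> set_decode (pfst (psnd z))"
        using True B[of "pfst z"] by auto
      then obtain k v s where k: "k = pfst z \<or> k \<in> set_decode (pfst (psnd z))"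
          "Q k v s" "set_decode v \<subseteq> A"
        using BQ by blast
      obtain t where "\<forall>j\<in>set_decode v. \<exists>i<t. f i = j"
        using finite_subset_range_bounded[of "set_decode v" f] k(3) range by auto
      then have "?P f z (prod_encode (k, prod_encode (v, prod_encode (s, t))))"
        using k by simp
      then show ?thesis by blast
    qed simp
    define w where "w z = (LEAST w. ?P f z w)" for z
    have w: "?P f z (w z)" for z
      unfolding w_def using ex by (rule LeastI_ex)
    have "?F f z = Some (?g (prod_encode (z, w z)))" for z
      using ex[of z] by (simp add: map_comp_def pair_op_def w_def)
    moreover have "?g (prod_encode (z, w z)) \<in> axiom_choices R B z" for z
    proof (cases "?R z")
      case True
      then have T: "?T f z (pfst (w z)) (pfst (psnd (w z))) (pfst (psnd (psnd (w z))))
          (psnd (psnd (psnd (w z))))" using w[of z] by blast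
      then have "set_decode (pfst (psnd (w z))) \<subseteq> A" using range by (metis rangeI subsetI)
      then have "pfst (w z) \<in> B" using BQ T by blast
      then show ?thesis using True T by (auto simp: axiom_choices_def)
    next
      case False
      then show ?thesis by (simp add: axiom_choices_def)
    qed
    ultimately show ?thesis
      by (intro bexI[of _ "\<lambda>z. ?g (prod_encode (z, w z))"]) auto
  qed
  then show ?thesis unfolding medvedev_reducible_def using F by blast
qed

theorem cototal_imp_compact:
  assumes "A \<noteq> {}" "cototal_enum_degree (enum_degree A)"
  shows "compact_medvedev_degree (medvedev_degree (enumerations A))"
proof -
  obtain B where AB: "enum_reducible A B" and BA: "enum_reducible B A"
      and cot: "enum_reducible B (- B)"
    using assms(2) by (auto simp: cototal_enum_degree_def enum_degree_def cototal_set_def)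
  obtain R where R: "decidable3 R" and B: "\<And>n. n \<in> B \<longleftrightarrow> (\<exists>u s. R n u s \<and> set_decode u \<subseteq> - B)"
    using enum_reducibleE[OF cot] by blast
  let ?K = "PiE UNIV (axiom_choices R B)"
  \<comment> \<open>A reduction valid on all lazy enumerations restricts to the subset
    \<open>?K\<close>.\<close>
  have "medvedev_reducible (enumerations A) ?K"
    using enumerations_reducible_lazy_enumerations[OF AB assms(1)]
      axiom_choices_lazy_enumerations[OF B]
    unfolding medvedev_reducible_def by blast
  moreover have "medvedev_reducible ?K (enumerations A)"
    by (rule axiom_choices_reducible_enumerations[OF R B BA])
  ultimately show ?thesis
    unfolding compact_medvedev_degree_def medvedev_degree_def
    using compact_axiom_choices by blast
qed

section \<open>Compact degrees are cototal\<close>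

definition cylinder :: "nat \<Rightarrow> (nat \<Rightarrow> nat) set" where
  "cylinder c = {f. \<forall>i<clen c. f i = cnth c i}"

lemma open_cylinder: "open (cylinder c)"
proof -
  have "open {f. \<forall>i\<in>{..<clen c}. f i \<in> {cnth c i}}"
    by (rule product_topology_basis'[of "{..<clen c}" "\<lambda>i. {cnth c i}" "\<lambda>i. i"])
      (auto simp: open_discrete)
  then show ?thesis by (simp only: cylinder_def lessThan_iff singleton_iff Ball_def)
qed

lemma prefix_code_cylinder: "f \<in> cylinder c \<Longrightarrow> prefix_code f (clen c) = c"
  by (rule prefix_code_eqI) (auto simp: cylinder_def)

lemma cylinder_prefix_code: "f \<in> cylinder (prefix_code f m)"
  by (simp add: cylinder_def)

definition noncovers :: "(nat \<Rightarrow> nat) set \<Rightarrow> nat set" where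
  "noncovers P = {u. \<exists>f\<in>P. \<forall>c\<in>set_decode u. f \<notin> cylinder c}"

text \<open>A point \<open>\<psi> g\<close> outside finitely many cylinders differs from each at
  some coordinate, and a finite prefix of \<open>g\<close> computes these coordinates. Conversely,
  any finite string over \<open>A\<close> with such outputs extends to an enumeration of
  \<open>A\<close>.\<close>

lemma noncovers_image_reducible:
  assumes F: "turing_functional F" and "A \<noteq> {}"
    and \<psi>: "\<And>g n. g \<in> enumerations A \<Longrightarrow> F g n = Some (\<psi> g n)"
  shows "enum_reducible (noncovers (\<psi> ` enumerations A)) A"
proof -
  obtain h where h: "stage_approx F h" using turing_functional_stage_approx[OF F] by blast
  obtain e :: "nat \<Rightarrow> nat" where e: "range e = A"
    using range_from_nat_into[OF \<open>A \<noteq> {}\<close> countableI_type] by blast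
  \<comment> \<open>The string \<open>t\<close> has its entries in \<open>v\<close>, and the
    approximation along \<open>t\<close> already contradicts every cylinder in
    \<open>u\<close>.\<close>
  let ?T = "\<lambda>u v t. (\<forall>i<clen t. cnth t i \<in> set_decode v) \<and>
    (\<forall>c\<in>set_decode u. \<exists>i<clen c. h t i \<noteq> 0 \<and> h t i \<noteq> Suc (cnth c i))"
  show ?thesis
  proof (rule enum_reducibleI)
    show "decidable3 ?T"
      unfolding decidable3_def by (intro computable_op_rules stage_approx_computable[OF h])
  next
    fix u
    show "u \<in> noncovers (\<psi> ` enumerations A) \<longleftrightarrow> (\<exists>v t. ?T u v t \<and> set_decode v \<subseteq> A)"
    proof
      assume "u \<in> noncovers (\<psi> ` enumerations A)"
      then obtain g where g: "g \<in> enumerations A" and avoid: "\<And>c. c \<in> set_decode u \<Longrightarrow> \<psi> g \<notin> cylinder c"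
        by (auto simp: noncovers_def)
      have "\<forall>\<^sub>F m in sequentially. \<exists>i<clen c. h (prefix_code g m) i \<noteq> 0 \<and> h (prefix_code g m) i \<noteq> Suc (cnth c i)"
        if c: "c \<in> set_decode u" for c
      proof -
        obtain i where i: "i < clen c" "\<psi> g i \<noteq> cnth c i"
          using avoid[OF c] by (auto simp: cylinder_def)
        from stage_approx_complete[OF h, OF \<psi>[OF g, of i]] show ?thesis
          by (rule eventually_mono) (use i in auto)
      qed
      then have "\<forall>\<^sub>F m in sequentially. \<forall>c\<in>set_decode u.
          \<exists>i<clen c. h (prefix_code g m) i \<noteq> 0 \<and> h (prefix_code g m) i \<noteq> Suc (cnth c i)"
        by (intro eventually_ball_finite) auto
      then obtain m where m: "\<forall>c\<in>set_decode u.
          \<exists>i<clen c. h (prefix_code g m) i \<noteq> 0 \<and> h (prefix_code g m) i \<noteq> Suc (cnth c i)"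
        using eventually_happens'[OF sequentially_bot] by blast
      let ?v = "set_encode (g ` {..<m})"
      have v: "set_decode ?v = g ` {..<m}" by (rule set_encode_inverse) simp
      have "?T u ?v (prefix_code g m)" using m unfolding v by simp
      moreover have "set_decode ?v \<subseteq> A" unfolding v using g by (auto simp: enumerations_def)
      ultimately show "\<exists>v t. ?T u v t \<and> set_decode v \<subseteq> A" by blast
    next
      assume "\<exists>v t. ?T u v t \<and> set_decode v \<subseteq> A"
      then obtain v t where T: "?T u v t" and v: "set_decode v \<subseteq> A" by blast
      \<comment> \<open>Following \<open>t\<close> by the enumeration \<open>e\<close> makes the
        range all of \<open>A\<close> while keeping the prefix.\<close>
      define g where "g i = (if i < clen t then cnth t i else e (i - clen t))" for i
      have "range g = A"
      proof
        show "range g \<subseteq> A" using T v e by (auto simp: g_def)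
        show "A \<subseteq> range g"
        proof
          fix a assume "a \<in> A"
          then obtain j where "a = e j" using e by auto
          then have "a = g (clen t + j)" by (simp add: g_def)
          then show "a \<in> range g" by simp
        qed
      qed
      then have g: "g \<in> enumerations A" by (simp add: enumerations_def)
      have t: "prefix_code g (clen t) = t" by (rule prefix_code_eqI) (simp add: g_def)
      have "\<psi> g \<notin> cylinder c" if c: "c \<in> set_decode u" for c
      proof -
        obtain i where i: "i < clen c" "h t i \<noteq> 0" "h t i \<noteq> Suc (cnth c i)"
          using T c by blast
        then obtain y where y: "h (prefix_code g (clen t)) i = Suc y"
          unfolding t using not0_implies_Suc by blast
        have "\<psi> g i = y" using stage_approx_sound[OF h, OF y] \<psi>[OF g, of i] by simp
        then show ?thesis using i y by (auto simp: cylinder_def t)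
      qed
      then show "u \<in> noncovers (\<psi> ` enumerations A)" using g by (auto simp: noncovers_def)
    qed
  qed
qed

text \<open>For \<open>n\<close> in \<open>A\<close>, the cylinders whose strings already yield
  output \<open>n\<close> form an open cover of \<open>K\<close>, and a finite subcover also covers
  \<open>P\<close>. Conversely, a point of \<open>P\<close> lies in one of the covering cylinders,
  so its image attains \<open>n\<close>.\<close>

lemma reducible_Compl_noncovers:
  assumes "compact K" and F: "turing_functional F"
    and \<phi>: "\<And>f n. f \<in> K \<Longrightarrow> F f n = Some (\<phi> f n)" "\<And>f. f \<in> K \<Longrightarrow> range (\<phi> f) = A"
    and P: "P \<subseteq> K" "P \<noteq> {}"
  shows "enum_reducible A (- noncovers P)"
proof -
  obtain h where h: "stage_approx F h" using turing_functional_stage_approx[OF F] by blast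
  \<comment> \<open>The premise \<open>w\<close> contains one candidate cover \<open>u\<close>; the
    bound \<open>s\<close> on the argument keeps the relation decidable.\<close>
  let ?T = "\<lambda>n w s. \<exists>u\<in>set_decode w. \<forall>c\<in>set_decode u. \<exists>x<s. h c x = Suc n"
  show ?thesis
  proof (rule enum_reducibleI)
    show "decidable3 ?T"
      unfolding decidable3_def by (intro computable_op_rules stage_approx_computable[OF h])
  next
    fix n
    show "n \<in> A \<longleftrightarrow> (\<exists>w s. ?T n w s \<and> set_decode w \<subseteq> - noncovers P)"
    proof
      assume n: "n \<in> A"
      let ?C = "{c. \<exists>x. h c x = Suc n}"
      have "K \<subseteq> (\<Union>c\<in>?C. cylinder c)"
      proof
        fix f assume f: "f \<in> K"
        then obtain x where x: "\<phi> f x = n" using \<phi>(2) n by blast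
        obtain m where "h (prefix_code f m) x = Suc n"
          using eventually_happens'[OF sequentially_bot stage_approx_complete[OF h, OF \<phi>(1)[OF f, of x]]] x
          by blast
        then show "f \<in> (\<Union>c\<in>?C. cylinder c)" using cylinder_prefix_code by blast
      qed
      then obtain C where C: "C \<subseteq> ?C" "finite C" "K \<subseteq> (\<Union>c\<in>C. cylinder c)"
        using compactE_image[OF \<open>compact K\<close>, of ?C cylinder] open_cylinder by metis
      from C(1) have "\<forall>c\<in>C. \<exists>x. h c x = Suc n" by blast
      then obtain X where X: "\<And>c. c \<in> C \<Longrightarrow> h c (X c) = Suc n" by metis
      have u: "set_decode (set_encode C) = C" using C(2) by (rule set_encode_inverse)
      have w: "set_decode (set_encode {set_encode C}) = {set_encode C}"
        by (rule set_encode_inverse) simp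
      have "X c < Suc (\<Sum>c\<in>C. X c)" if "c \<in> C" for c
        using member_le_sum[OF that, of X] C(2) by (simp add: less_Suc_eq_le)
      then have "?T n (set_encode {set_encode C}) (Suc (\<Sum>c\<in>C. X c))"
        unfolding w using X u by auto
      moreover have "set_encode C \<notin> noncovers P"
        using C(3) P(1) by (auto simp: noncovers_def u)
      ultimately show "\<exists>w s. ?T n w s \<and> set_decode w \<subseteq> - noncovers P"
        using w by (metis Compl_iff empty_subsetI insert_subset)
    next
      assume "\<exists>w s. ?T n w s \<and> set_decode w \<subseteq> - noncovers P"
      then obtain u where u: "u \<notin> noncovers P" "\<And>c. c \<in> set_decode u \<Longrightarrow> \<exists>x. h c x = Suc n"
        by blast
      \<comment> \<open>Nonemptiness of \<open>P\<close> rules out the empty cover, which would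
        vacuously yield every \<open>n\<close>.\<close>
      obtain f where f: "f \<in> P" using P(2) by blast
      then obtain c where c: "c \<in> set_decode u" "f \<in> cylinder c"
        using u(1) by (auto simp: noncovers_def)
      obtain x where x: "h c x = Suc n" using u(2)[OF c(1)] by blast
      have "h (prefix_code f (clen c)) x = Suc n"
        using x prefix_code_cylinder[OF c(2)] by simp
      from stage_approx_sound[OF h, OF this] have "\<phi> f x = n" using \<phi>(1) f P(1) by force
      then show "n \<in> A" using \<phi>(2) f P(1) by blast
    qed
  qed
qed

section \<open>Joins and the cototal representative\<close>

definition enum_join :: "nat set \<Rightarrow> nat set \<Rightarrow> nat set" where
  "enum_join A B = {z. if pfst z = 0 then psnd z \<in> A else psnd z \<in> B}"

text \<open>A many-one reduction is an enumeration reduction: membership of \<open>n\<close> needs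
  only the premise \<open>{g n}\<close>.\<close>

lemma enum_reducible_preimage:
  assumes "computable_op (\<lambda>_. g)" "\<And>n. n \<in> A \<longleftrightarrow> g n \<in> B"
  shows "enum_reducible A B"
proof (rule enum_reducibleI)
  show "decidable3 (\<lambda>n u s. g n \<in> set_decode u)"
    unfolding decidable3_def by (intro computable_op_rules computable_op_app[OF assms(1)])
  show "n \<in> A \<longleftrightarrow> (\<exists>u s. g n \<in> set_decode u \<and> set_decode u \<subseteq> B)" for n
  proof
    assume "n \<in> A"
    moreover have "set_decode (set_encode {g n}) = {g n}" by (rule set_encode_inverse) simp
    ultimately show "\<exists>u s. g n \<in> set_decode u \<and> set_decode u \<subseteq> B"
      using assms(2) by (metis empty_subsetI insert_subset singletonI)
  qed (use assms(2) in blast)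
qed

lemma enum_reducible_joinI:
  assumes "enum_reducible A C" "enum_reducible B C"
  shows "enum_reducible (enum_join A B) C"
proof -
  obtain R where R: "decidable3 R" and A: "\<And>n. n \<in> A \<longleftrightarrow> (\<exists>u s. R n u s \<and> set_decode u \<subseteq> C)"
    using enum_reducibleE[OF assms(1)] by blast
  obtain Q where Q: "decidable3 Q" and B: "\<And>n. n \<in> B \<longleftrightarrow> (\<exists>u s. Q n u s \<and> set_decode u \<subseteq> C)"
    using enum_reducibleE[OF assms(2)] by blast
  let ?T = "\<lambda>n u s. (pfst n = 0 \<and> R (psnd n) u s) \<or> (pfst n \<noteq> 0 \<and> Q (psnd n) u s)"
  show ?thesis
  proof (rule enum_reducibleI)
    show "decidable3 ?T"
      unfolding decidable3_def
      by (intro computable_op_rules decidable3_app[OF R] decidable3_app[OF Q])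
    show "n \<in> enum_join A B \<longleftrightarrow> (\<exists>u s. ?T n u s \<and> set_decode u \<subseteq> C)" for n
      using A B by (auto simp: enum_join_def)
  qed
qed

lemma enum_reducible_refl: "enum_reducible A A"
  by (rule enum_reducible_preimage[OF computable_op_id]) simp

lemma enum_reducible_join1: "enum_reducible A (enum_join A B)"
  by (rule enum_reducible_preimage[where g = "\<lambda>n. prod_encode (0, n)"])
    (auto simp: enum_join_def intro!: computable_op_rules)

text \<open>Every nonzero tag counts for the second set, so complementing a join complements both
  components.\<close>

lemma enum_reducible_Compl_join2: "enum_reducible (- B) (- enum_join A B)"
  by (rule enum_reducible_preimage[where g = "\<lambda>n. prod_encode (1, n)"])
    (auto simp: enum_join_def intro!: computable_op_rules)

theorem compact_imp_cototal:
  assumes "A \<noteq> {}" "compact_medvedev_degree (medvedev_degree (enumerations A))"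
  shows "cototal_enum_degree (enum_degree A)"
proof -
  obtain K where "compact K" and EK: "medvedev_reducible (enumerations A) K"
      and KE: "medvedev_reducible K (enumerations A)"
    using assms(2) by (auto simp: compact_medvedev_degree_def medvedev_degree_def)
  obtain F \<phi> where F: "turing_functional F"
      and \<phi>: "\<And>f n. f \<in> K \<Longrightarrow> F f n = Some (\<phi> f n)" "\<And>f. f \<in> K \<Longrightarrow> range (\<phi> f) = A"
    using EK unfolding medvedev_reducible_def enumerations_def Bex_def mem_Collect_eq by metis
  obtain G \<psi> where G: "turing_functional G"
      and \<psi>: "\<And>g n. g \<in> enumerations A \<Longrightarrow> G g n = Some (\<psi> g n)"
        "\<And>g. g \<in> enumerations A \<Longrightarrow> \<psi> g \<in> K"
    using KE unfolding medvedev_reducible_def by metis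
  \<comment> \<open>Covers are tested on the image of \<open>\<psi>\<close>, where a finite part of
    an enumeration of \<open>A\<close> witnesses noncovering; compactness is used for the larger
    \<open>K\<close>.\<close>
  let ?P = "\<psi> ` enumerations A"
  let ?B = "noncovers ?P"
  have "enumerations A \<noteq> {}"
    using range_from_nat_into[OF \<open>A \<noteq> {}\<close> countableI_type] by (auto simp: enumerations_def)
  then have P: "?P \<subseteq> K" "?P \<noteq> {}" using \<psi>(2) by auto
  have "enum_reducible ?B A"
    by (rule noncovers_image_reducible[OF G \<open>A \<noteq> {}\<close> \<psi>(1)])
  then have J: "enum_reducible (enum_join A ?B) A"
    by (intro enum_reducible_joinI enum_reducible_refl)
  have "enum_reducible A (- ?B)"
    by (rule reducible_Compl_noncovers[OF \<open>compact K\<close> F \<phi> P])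
  \<comment> \<open>The chain runs from the join to \<open>A\<close>, then to the complement of
    \<open>?B\<close>, then to the complement of the join.\<close>
  then have "enum_reducible (enum_join A ?B) (- enum_join A ?B)"
    using J enum_reducible_Compl_join2 enum_reducible_trans by blast
  then show ?thesis
    using J enum_reducible_join1
    by (auto simp: cototal_enum_degree_def enum_degree_def cototal_set_def)
qed

theorem theorem17:
  shows "(\<forall>A :: nat set. A \<noteq> {} \<longrightarrow>
            (compact_medvedev_degree (medvedev_degree (enumerations A)) \<longleftrightarrow>
             cototal_enum_degree (enum_degree A))) \<and>
         (\<forall>d. degree_of_enumerability d \<longrightarrow>
            (compact_medvedev_degree d \<longleftrightarrow> cototal_degree_of_enumerability d))"
  \<comment> \<open>The second equivalence follows from the first: compactness depends only on
    \<open>d\<close>, so it can be tested at any representing set.\<close>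
  unfolding degree_of_enumerability_def cototal_degree_of_enumerability_def
  using compact_imp_cototal cototal_imp_compact by blast

end
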